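(* Let $H^2$ be the Lobachevsky (hyperbolic) plane. For any partition $H^2=B_1\cup\dots\cup B_m$ of $H^2$ into finitely many Borel pieces, one of the pieces $B_i$ contains an unbounded subset $S$ that is centrally symmetric, i.e. there is a point $c\in H^2$ with $f_c(S)=S$.
   Context: For a point $c\in H^2$, the central symmetry $f_c:H^2\to H^2$ is the involutive isometry assigning to each $x\in H^2$ the unique point $y\in H^2$ such that $c$ is the midpoint of the hyperbolic segment $[x,y]$. A subset $S\subset H^2$ is symmetric with respect to $c$ if $f_c(S)=S$. "Unbounded" refers to the hyperbolic metric. *)

theory Defs
  imports "HOL-Analysis.Analysis"
begin

text \<open>
  The hyperbolic plane in the Poincare upper half-plane model (curvature \<open>-1\<close>). It is a type of
  its own, so that \<^const>\<open>dist\<close>, \<^const>\<open>bounded\<close> and \<^const>\<open>borel\<close> on it refer to the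
  hyperbolic metric.
\<close>

typedef hyp_plane = "{z :: complex. Im z > 0}"
  morphisms hcoord hpoint
  by (rule exI[of _ \<i>]) simp

lemma Im_hcoord_pos: "Im (hcoord p) > 0"
  using hcoord[of p] by simp

lemma hyp_ptolemy:
  "cmod (x - cnj x) * cmod (z - w) \<le> cmod (z - x) * cmod (x - cnj w) + cmod (z - cnj x) * cmod (x - w)"
proof -
  have "(cnj x - x) * (z - w) = (z - x) * (cnj x - w) + (z - cnj x) * (w - x)"
    by (simp add: algebra_simps)
  then have "cmod (cnj x - x) * cmod (z - w) \<le> cmod (z - x) * cmod (cnj x - w) + cmod (z - cnj x) * cmod (w - x)"
    by (metis norm_mult norm_triangle_ineq)
  moreover have "cmod (cnj x - w) = cmod (x - cnj w)"
    by (metis complex_cnj_cnj complex_cnj_diff complex_mod_cnj)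
  ultimately show ?thesis
    by (simp add: norm_minus_commute)
qed

instantiation hyp_plane :: metric_space
begin

definition dist_hyp_plane :: "hyp_plane \<Rightarrow> hyp_plane \<Rightarrow> real" where
  "dist p q = 2 * arsinh (cmod (hcoord p - hcoord q) / (2 * sqrt (Im (hcoord p) * Im (hcoord q))))"

definition uniformity_hyp_plane :: "(hyp_plane \<times> hyp_plane) filter" where
  "uniformity_hyp_plane = (INF e\<in>{0<..}. principal {(p, q). dist p q < e})"

definition open_hyp_plane :: "hyp_plane set \<Rightarrow> bool" where
  "open_hyp_plane U \<longleftrightarrow> (\<forall>p\<in>U. eventually (\<lambda>(p', q). p' = p \<longrightarrow> q \<in> U) uniformity)"

lemma hyp_sinh_half_dist:
  "sinh (dist p q / 2) = cmod (hcoord p - hcoord q) / (2 * sqrt (Im (hcoord p) * Im (hcoord q)))"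
  by (simp add: dist_hyp_plane_def)

lemma hyp_cosh_half_dist:
  "cosh (dist p q / 2) = cmod (hcoord p - cnj (hcoord q)) / (2 * sqrt (Im (hcoord p) * Im (hcoord q)))"
proof (rule power2_eq_imp_eq)
  let ?z = "hcoord p" and ?w = "hcoord q"
  have pos: "Im ?z > 0" "Im ?w > 0" by (rule Im_hcoord_pos)+
  have "(cosh (dist p q / 2))\<^sup>2 = 1 + (cmod (?z - ?w))\<^sup>2 / (4 * (Im ?z * Im ?w))"
    using pos by (simp add: cosh_square_eq hyp_sinh_half_dist power_divide power_mult_distrib)
  also have "\<dots> = (cmod (?z - cnj ?w))\<^sup>2 / (4 * (Im ?z * Im ?w))"
  proof -
    have "(cmod (?z - cnj ?w))\<^sup>2 = (cmod (?z - ?w))\<^sup>2 + 4 * (Im ?z * Im ?w)"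
      unfolding cmod_power2 by (simp add: algebra_simps power2_eq_square)
    then show ?thesis using pos by (simp add: add_divide_distrib)
  qed
  finally show "(cosh (dist p q / 2))\<^sup>2 = (cmod (?z - cnj ?w) / (2 * sqrt (Im ?z * Im ?w)))\<^sup>2"
    using pos by (simp add: power_divide power_mult_distrib)
qed (auto intro!: divide_nonneg_nonneg simp: less_imp_le Im_hcoord_pos)

lemma hyp_sinh_half_dist_add:
  "sinh (dist p r / 2 + dist r q / 2) =
    (cmod (hcoord p - hcoord r) * cmod (hcoord r - cnj (hcoord q)) +
     cmod (hcoord p - cnj (hcoord r)) * cmod (hcoord r - hcoord q)) /
    (4 * Im (hcoord r) * sqrt (Im (hcoord p) * Im (hcoord q)))"
proof -
  define a where "a = sqrt (Im (hcoord p))"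
  define b where "b = sqrt (Im (hcoord q))"
  define t where "t = sqrt (Im (hcoord r))"
  have pos: "a > 0" "b > 0" "t > 0"
    by (simp_all add: a_def b_def t_def Im_hcoord_pos)
  have t2: "Im (hcoord r) = t * t"
    using Im_hcoord_pos[of r] by (simp add: t_def)
  show ?thesis
    unfolding sinh_add hyp_sinh_half_dist hyp_cosh_half_dist real_sqrt_mult
      a_def[symmetric] b_def[symmetric] t_def[symmetric] t2
    using pos by (simp add: field_simps)
qed

instance
proof
  fix p q r :: hyp_plane
  show "dist p q = 0 \<longleftrightarrow> p = q"
    using Im_hcoord_pos[of p] Im_hcoord_pos[of q]
    by (auto simp: dist_hyp_plane_def hcoord_inject)
  show "dist p q \<le> dist p r + dist q r"
  proof -
    have comm: "dist q r = dist r q"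
      by (simp add: dist_hyp_plane_def norm_minus_commute mult.commute)
    have im: "cmod (hcoord r - cnj (hcoord r)) = 2 * Im (hcoord r)"
      using Im_hcoord_pos[of r] by (simp add: complex_diff_cnj norm_mult)
    have "sinh (dist p q / 2) = (cmod (hcoord r - cnj (hcoord r)) * cmod (hcoord p - hcoord q)) /
        (4 * Im (hcoord r) * sqrt (Im (hcoord p) * Im (hcoord q)))"
      unfolding hyp_sinh_half_dist im using Im_hcoord_pos[of r] by simp
    also have "\<dots> \<le> sinh (dist p r / 2 + dist r q / 2)"
      unfolding hyp_sinh_half_dist_add
      using Im_hcoord_pos[of p] Im_hcoord_pos[of q] Im_hcoord_pos[of r]
      by (intro divide_right_mono hyp_ptolemy) (simp add: less_imp_le)
    finally show ?thesis
      by (simp add: comm)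
  qed
qed (simp_all add: uniformity_hyp_plane_def open_hyp_plane_def)

end

text \<open>
  The geodesic segment is encoded by metric betweenness. Hence, the midpoint is the point of the
  segment equidistant from its endpoints, and \<open>central_symmetry\<close> is well defined
  (see \<open>is_hyp_midpoint_central_symmetry\<close> and \<open>hyp_reflection_unique\<close>).
\<close>

definition hyp_segment :: "hyp_plane \<Rightarrow> hyp_plane \<Rightarrow> hyp_plane set" where
  "hyp_segment p q = {r. dist p r + dist r q = dist p q}"

definition is_hyp_midpoint :: "hyp_plane \<Rightarrow> hyp_plane \<Rightarrow> hyp_plane \<Rightarrow> bool" where
  "is_hyp_midpoint c p q \<longleftrightarrow> c \<in> hyp_segment p q \<and> dist p c = dist c q"

definition central_symmetry :: "hyp_plane \<Rightarrow> hyp_plane \<Rightarrow> hyp_plane" where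
  "central_symmetry c p = (THE q. is_hyp_midpoint c p q)"

lemma ex_hyp_reflection: "\<exists>q. is_hyp_midpoint c p q"
proof -
  define z where "z = hcoord p"
  define u where "u = complex_of_real (Re (hcoord c))"
  define v where "v = Im (hcoord c)"
  define w where "w = u - v\<^sup>2 / (z - u)"
  have v: "v > 0" and z: "Im z > 0"
    by (simp_all add: v_def z_def Im_hcoord_pos)
  have hc: "hcoord c = u + \<i> * v"
    by (simp add: u_def v_def complex_eq_iff)
  have cc: "cnj (hcoord c) = u - \<i> * v"
    by (simp add: u_def v_def complex_eq_iff)
  have zu: "z - u \<noteq> 0"
    using z by (auto simp: u_def complex_eq_iff)
  have Imzu: "Im (z - u) = Im z" by (simp add: u_def)
  have Imw: "Im w = v\<^sup>2 * Im z / (cmod (z - u))\<^sup>2"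
    unfolding w_def cmod_power2 by (simp add: Im_divide u_def power2_eq_square)
  have w: "Im w > 0"
    unfolding Imw using v z zu by simp
  define q where "q = hpoint w"
  have hq: "hcoord q = w"
    unfolding q_def using w by (simp add: hpoint_inverse)
  have "hcoord c - w = \<i> * v * (z - hcoord c) / (z - u)"
    unfolding hc w_def using zu by (simp add: field_simps power2_eq_square)
  then have cw: "cmod (hcoord c - w) = v * cmod (z - hcoord c) / cmod (z - u)"
    using v by (simp add: norm_mult norm_divide)
  have "z - w = (z - hcoord c) * (z - cnj (hcoord c)) / (z - u)"
    unfolding cc unfolding hc w_def using zu by (simp add: field_simps power2_eq_square)
  then have zw: "cmod (z - w) = cmod (z - hcoord c) * cmod (z - cnj (hcoord c)) / cmod (z - u)"
    by (simp add: norm_mult norm_divide)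
  have "sinh (dist c q / 2) = sinh (dist p c / 2)"
    unfolding hyp_sinh_half_dist hq cw z_def[symmetric] v_def[symmetric] Imw
    using v z zu by (simp add: real_sqrt_mult real_sqrt_divide field_simps)
  then have d1: "dist p c = dist c q" by simp
  have "sinh (dist p q / 2) = 2 * sinh (dist p c / 2) * cosh (dist p c / 2)"
    unfolding hyp_sinh_half_dist hyp_cosh_half_dist hq zw z_def[symmetric] v_def[symmetric] Imw
    using v z zu by (simp add: real_sqrt_mult real_sqrt_divide field_simps)
  also have "\<dots> = sinh (dist p c)"
    using sinh_double[of "dist p c / 2"] by simp
  finally have "dist p q / 2 = dist p c" by simp
  with d1 show ?thesis
    by (auto simp: is_hyp_midpoint_def hyp_segment_def intro!: exI[of _ q])
qed

lemma hyp_reflection_unique: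
  assumes "is_hyp_midpoint c p q" "is_hyp_midpoint c p q'"
  shows "q = q'"
proof -
  define z where "z = hcoord p"
  define x where "x = hcoord c"
  have *: "(z - x) * (cnj x - hcoord q) = (z - cnj x) * (hcoord q - x)"
    if m: "is_hyp_midpoint c p q" for q
  proof -
    define w where "w = hcoord q"
    have pos: "Im z > 0" "Im w > 0" "Im x > 0"
      by (simp_all add: z_def w_def x_def Im_hcoord_pos)
    define A where "A = (z - x) * (cnj x - w)"
    define B where "B = (z - cnj x) * (w - x)"
    have d: "dist p c = dist c q" and s: "dist p c + dist c q = dist p q"
      using m by (auto simp: is_hyp_midpoint_def hyp_segment_def)
    have cm: "cmod (cnj x - w) = cmod (x - cnj w)"
      by (metis complex_cnj_cnj complex_cnj_diff complex_mod_cnj)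
    have im: "cmod (cnj x - x) = 2 * Im x"
      using pos(3) by (simp add: norm_minus_commute[of "cnj x"] complex_diff_cnj norm_mult)
    have AB: "A + B = (cnj x - x) * (z - w)"
      by (simp add: A_def B_def algebra_simps)
    have nA: "cmod A = cmod (z - x) * cmod (x - cnj w)"
      by (simp add: A_def norm_mult cm)
    have nB: "cmod B = cmod (z - cnj x) * cmod (x - w)"
      by (simp add: B_def norm_mult norm_minus_commute)
    have "sinh (dist p c / 2 + dist c q / 2) = sinh (dist p q / 2)"
      using s by (simp flip: add_divide_distrib)
    moreover have "a = 2 * b * e" if "a / (4 * b * t) = e / (2 * t)" "b > 0" "t > 0" for a b e t :: real
      using that by (simp add: field_simps)
    ultimately have "cmod A + cmod B = cmod (A + B)"
      unfolding hyp_sinh_half_dist_add hyp_sinh_half_dist AB norm_mult im nA nB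
        z_def[symmetric] x_def[symmetric] w_def[symmetric]
      using pos by (metis mult_pos_pos real_sqrt_gt_zero)
    then have tri: "cmod A *\<^sub>R B = cmod B *\<^sub>R A"
      by (metis norm_triangle_eq)
    have "sinh (dist p c / 2) * cosh (dist c q / 2) = cosh (dist p c / 2) * sinh (dist c q / 2)"
      by (simp add: d)
    then have "cmod A = cmod B"
      unfolding hyp_sinh_half_dist hyp_cosh_half_dist nA nB
        z_def[symmetric] x_def[symmetric] w_def[symmetric]
      using pos by (simp add: field_simps)
    with tri have "A = B"
      by (cases "A = 0") auto
    then show ?thesis by (simp add: A_def B_def w_def)
  qed
  have nz: "2 * z - x - cnj x \<noteq> 0"
    using Im_hcoord_pos[of p] by (auto simp: complex_eq_iff z_def)
  have "(2 * z - x - cnj x) * (hcoord q - hcoord q') = 0"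
    using *[OF assms(1)] *[OF assms(2)] by algebra
  with nz show ?thesis
    by (simp add: hcoord_inject)
qed

lemma is_hyp_midpoint_central_symmetry: "is_hyp_midpoint c p (central_symmetry c p)"
  unfolding central_symmetry_def
  by (rule theI') (use ex_hyp_reflection hyp_reflection_unique in blast)

definition symmetric_wrt :: "hyp_plane set \<Rightarrow> hyp_plane \<Rightarrow> bool" where
  "symmetric_wrt S c \<longleftrightarrow> central_symmetry c ` S = S"

end

theory Submission
  imports Defs
begin

text \<open>
  For \<open>r\<^sup>2 + h\<^sup>2 = v\<^sup>2\<close> the symmetry at \<open>u + iv\<close> swaps the points \<open>u \<plusminus> r + ih\<close>, which lie on a common
  horocycle. If no piece contained an unbounded symmetric set, then for each fixed \<open>(u, v\<^sup>2)\<close> these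
  two points would lie in different pieces once \<open>h\<close> is small; by dominated convergence, the measure of
  the set of exceptional \<open>(u, v\<^sup>2)\<close> in a fixed box tends to \<open>0\<close> with \<open>h\<close>. On the other hand, for all
  \<open>t\<close> and \<open>s\<close> two of the \<open>m + 1\<close> points \<open>t + s k + ih\<close>, \<open>k = 0, \<dots>, m\<close>, lie in the same piece, which
  bounds the measure of the exceptional set from below: in the coordinates \<open>(t, s\<^sup>2)\<close> the passage
  from two of these points to \<open>(u, v\<^sup>2)\<close> is a shear followed by an affine map not depending on \<open>h\<close>
  up to translation.
\<close>

subsection \<open>Central symmetries\<close>

lemma central_symmetry_eqI: "is_hyp_midpoint c p q \<Longrightarrow> central_symmetry c p = q"
  using hyp_reflection_unique is_hyp_midpoint_central_symmetry by blast

lemma is_hyp_midpoint_commute: "is_hyp_midpoint c p q \<Longrightarrow> is_hyp_midpoint c q p"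
  by (auto simp: is_hyp_midpoint_def hyp_segment_def dist_commute)

lemma central_symmetry_involution [simp]: "central_symmetry c (central_symmetry c p) = p"
  using central_symmetry_eqI is_hyp_midpoint_central_symmetry is_hyp_midpoint_commute by blast

text \<open>As the symmetry is an involution, this is the largest subset of \<open>B\<close>
  symmetric about \<open>c\<close>. If it is bounded, so is every other one.\<close>

lemma symmetric_wrt_Int_vimage: "symmetric_wrt {p \<in> B. central_symmetry c p \<in> B} c"
  unfolding symmetric_wrt_def
proof (intro set_eqI iffI)
  fix p assume "p \<in> {p \<in> B. central_symmetry c p \<in> B}"
  then show "p \<in> central_symmetry c ` {p \<in> B. central_symmetry c p \<in> B}"
    by (intro image_eqI[of _ _ "central_symmetry c p"]) auto
qed auto

abbreviation hyp_xy :: "real \<Rightarrow> real \<Rightarrow> hyp_plane" where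
  "hyp_xy x y \<equiv> hpoint (Complex x y)"

lemma hcoord_hyp_xy: "y > 0 \<Longrightarrow> hcoord (hyp_xy x y) = Complex x y"
  by (simp add: hpoint_inverse)

lemma sinh_half_dist_horocycle:
  assumes "h > 0"
  shows "sinh (dist (hyp_xy x h) (hyp_xy y h) / 2) = \<bar>x - y\<bar> / (2 * h)"
  using assms by (simp add: hyp_sinh_half_dist hcoord_hyp_xy cmod_def)

text \<open>Makes the traces of Borel pieces on a horocycle Borel subsets of the real line.\<close>

lemma continuous_on_hyp_xy_horocycle:
  assumes "h > 0"
  shows "continuous_on UNIV (\<lambda>x. hyp_xy x h)"
proof -
  have eq: "dist (hyp_xy y h) (hyp_xy x h) = 2 * arsinh (\<bar>y - x\<bar> / (2 * h))" for x y
    using assms by (simp add: dist_hyp_plane_def hcoord_hyp_xy cmod_def)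
  have "((\<lambda>y. 2 * arsinh (\<bar>y - x\<bar> / (2 * h))) \<longlongrightarrow> 2 * arsinh (\<bar>x - x\<bar> / (2 * h))) (at x)" for x
    using assms by (intro tendsto_intros) auto
  then show ?thesis
    unfolding continuous_on_def tendsto_dist_iff[of _ "hyp_xy _ h"] eq by simp
qed

text \<open>The three points lie on the Euclidean half-circle of radius \<open>v\<close> about the
  real number \<open>u\<close>, a geodesic with top \<open>hyp_xy u v\<close>, and reflection in its
  vertical axis swaps the two endpoints.\<close>

lemma is_hyp_midpoint_horocycle:
  assumes "h > 0" "v > 0" "r \<ge> 0" "r\<^sup>2 + h\<^sup>2 = v\<^sup>2"
  shows "is_hyp_midpoint (hyp_xy u v) (hyp_xy (u + r) h) (hyp_xy (u - r) h)"
proof -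
  let ?c = "hyp_xy u v" and ?p = "hyp_xy (u + r) h" and ?q = "hyp_xy (u - r) h"
  have eq: "dist ?p ?c = dist ?c ?q"
    using assms(1,2)
    by (simp add: dist_hyp_plane_def hcoord_hyp_xy cmod_def power2_commute mult.commute)
  \<comment> \<open>Up to a constant factor and \<open>h * v\<close>, this product is
    \<open>sinh * cosh\<close> of half the distance to the centre, so the doubling formula
    applies.\<close>
  have "sqrt (r\<^sup>2 + (h - v)\<^sup>2) * sqrt (r\<^sup>2 + (h + v)\<^sup>2) = 2 * v * r"
  proof -
    have "(r\<^sup>2 + (h - v)\<^sup>2) * (r\<^sup>2 + (h + v)\<^sup>2) = (r\<^sup>2 + h\<^sup>2 + v\<^sup>2)\<^sup>2 - 4 * h\<^sup>2 * v\<^sup>2"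
      by algebra
    also have "\<dots> = (2 * v * r)\<^sup>2"
      using assms(4) by algebra
    finally show ?thesis
      using assms by (simp flip: real_sqrt_mult)
  qed
  then have "sinh (dist ?p ?c) = r / h"
    using sinh_double[of "dist ?p ?c / 2"] assms(1,2)
    by (simp add: hyp_sinh_half_dist hyp_cosh_half_dist hcoord_hyp_xy cmod_def field_simps)
  also have "\<dots> = sinh (dist ?p ?q / 2)"
    using sinh_half_dist_horocycle[OF assms(1), of "u + r" "u - r"] assms by simp
  finally have "dist ?p ?c = dist ?p ?q / 2" by simp
  with eq show ?thesis
    by (simp add: is_hyp_midpoint_def hyp_segment_def)
qed

text \<open>If both points lie in \<open>B\<close>, both lie in the bounded symmetric set. But the
  \<open>sinh\<close> of half their distance is \<open>r / h n\<close> with \<open>r\<close> tending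
  to \<open>sqrt w > 0\<close>, so their distance tends to infinity.\<close>

lemma eventually_horocycle_pair_separated:
  fixes h :: "nat \<Rightarrow> real"
  assumes h: "\<And>n. h n > 0" "h \<longlonglongrightarrow> 0" and w: "w > 0"
    and bdd: "bounded {p \<in> B. central_symmetry (hyp_xy u (sqrt w)) p \<in> B}"
  shows "\<forall>\<^sub>F n in sequentially. (h n)\<^sup>2 < w \<longrightarrow>
    \<not> (hyp_xy (u + sqrt (w - (h n)\<^sup>2)) (h n) \<in> B \<and> hyp_xy (u - sqrt (w - (h n)\<^sup>2)) (h n) \<in> B)"
proof -
  let ?c = "hyp_xy u (sqrt w)"
  let ?S = "{p \<in> B. central_symmetry ?c p \<in> B}"
  obtain M where M: "dist p q \<le> M" if "p \<in> ?S" "q \<in> ?S" for p q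
    using bdd unfolding bounded_two_points by blast
  \<comment> \<open>A pair inside \<open>?S\<close> has \<open>r \<le> K * h n\<close>, hence
    \<open>w = r\<^sup>2 + (h n)\<^sup>2 \<le> (h n)\<^sup>2 * (1 + K\<^sup>2)\<close>, which fails
    for large \<open>n\<close>.\<close>
  define K where "K = sinh (M / 2)"
  have "(\<lambda>n. (h n)\<^sup>2 * (1 + K\<^sup>2)) \<longlonglongrightarrow> 0\<^sup>2 * (1 + K\<^sup>2)"
    by (intro tendsto_intros h)
  then have "\<forall>\<^sub>F n in sequentially. (h n)\<^sup>2 * (1 + K\<^sup>2) < w"
    using w by (intro order_tendstoD(2)) auto
  then show ?thesis
  proof (eventually_elim, intro impI notI, elim conjE)
    fix n
    define r where "r = sqrt (w - (h n)\<^sup>2)"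
    let ?p = "hyp_xy (u + r) (h n)" and ?q = "hyp_xy (u - r) (h n)"
    assume less: "(h n)\<^sup>2 * (1 + K\<^sup>2) < w" and hw: "(h n)\<^sup>2 < w"
      and B: "hyp_xy (u + sqrt (w - (h n)\<^sup>2)) (h n) \<in> B" "hyp_xy (u - sqrt (w - (h n)\<^sup>2)) (h n) \<in> B"
    have r: "r \<ge> 0" "r\<^sup>2 + (h n)\<^sup>2 = w"
      using hw by (simp_all add: r_def)
    have mid: "is_hyp_midpoint ?c ?p ?q"
      using r w h by (intro is_hyp_midpoint_horocycle) auto
    have "dist ?p ?q \<le> M"
      using B central_symmetry_eqI[OF mid] central_symmetry_eqI[OF is_hyp_midpoint_commute[OF mid]]
      by (intro M) (auto simp: r_def)
    then have "sinh (dist ?p ?q / 2) \<le> K"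
      by (simp add: K_def)
    then have "r / h n \<le> K"
      using sinh_half_dist_horocycle[OF h(1)[of n], of "u + r" "u - r"] r by simp
    then have "r \<le> K * h n"
      using h(1)[of n] by (simp add: pos_divide_le_eq)
    then have "r\<^sup>2 \<le> (K * h n)\<^sup>2"
      using r by (intro power_mono)
    with r less show False
      by (simp add: algebra_simps power_mult_distrib)
  qed
qed

subsection \<open>Coloured horocycles\<close>

text \<open>Integrating over \<open>y\<close> first removes the shear by translation invariance; the
  substitution in \<open>x\<close> then contributes the factor \<open>1 / \<beta>\<close>.\<close>

lemma nn_integral_shear_affine:
  fixes f :: "real \<times> real \<Rightarrow> ennreal"
  assumes [measurable]: "f \<in> borel_measurable (lborel \<Otimes>\<^sub>M lborel)" "g \<in> borel_measurable borel"
    and "\<beta> > 0"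
  shows "(\<integral>\<^sup>+ x. \<integral>\<^sup>+ y. f (\<gamma> + \<beta> * x, y + g x) \<partial>lborel \<partial>lborel)
    = ennreal (1 / \<beta>) * (\<integral>\<^sup>+ z. f z \<partial>(lborel \<Otimes>\<^sub>M lborel))"
proof -
  have shift: "(\<integral>\<^sup>+ y. f (w, y + a) \<partial>lborel) = (\<integral>\<^sup>+ y. f (w, y) \<partial>lborel)" for w a
    using nn_integral_real_affine[of "\<lambda>y. f (w, y)" 1 a] by (simp add: add.commute)
  have "(\<integral>\<^sup>+ z. f z \<partial>(lborel \<Otimes>\<^sub>M lborel)) = (\<integral>\<^sup>+ w. \<integral>\<^sup>+ y. f (w, y) \<partial>lborel \<partial>lborel)"
    by (rule lborel.nn_integral_fst[symmetric]) measurable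
  also have "\<dots> = ennreal \<beta> * (\<integral>\<^sup>+ x. \<integral>\<^sup>+ y. f (\<gamma> + \<beta> * x, y) \<partial>lborel \<partial>lborel)"
    using nn_integral_real_affine[of "\<lambda>w. \<integral>\<^sup>+ y. f (w, y) \<partial>lborel" \<beta> \<gamma>] assms(3) by simp
  finally have "ennreal (1 / \<beta>) * (\<integral>\<^sup>+ z. f z \<partial>(lborel \<Otimes>\<^sub>M lborel))
    = ennreal (1 / \<beta>) * ennreal \<beta> * (\<integral>\<^sup>+ x. \<integral>\<^sup>+ y. f (\<gamma> + \<beta> * x, y) \<partial>lborel \<partial>lborel)"
    by (simp add: mult.assoc)
  also have "ennreal (1 / \<beta>) * ennreal \<beta> = 1"
    using assms(3) by (simp flip: ennreal_mult)
  finally show ?thesis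
    by (simp add: shift)
qed

text \<open>\<open>A n i\<close> stands for the trace of piece \<open>i\<close> on the horocycle at
  height \<open>h n\<close>, and \<open>w\<close> for the squared height of the centre. The point is
  that one \<open>(u, w)\<close> serves infinitely many \<open>n\<close>.\<close>

lemma frequently_monochromatic_pair:
  fixes h :: "nat \<Rightarrow> real" and A :: "nat \<Rightarrow> nat \<Rightarrow> real set"
  assumes h: "\<And>n. h n > 0" "h \<longlonglongrightarrow> 0"
    and meas: "\<And>n i. i \<in> {1..m} \<Longrightarrow> A n i \<in> sets borel"
    and cover: "\<And>n x. \<exists>i\<in>{1..m}. x \<in> A n i"
  shows "\<exists>u w. w > 0 \<and> (\<exists>\<^sub>F n in sequentially. (h n)\<^sup>2 < w \<and>
    (\<exists>i\<in>{1..m}. u + sqrt (w - (h n)\<^sup>2) \<in> A n i \<and> u - sqrt (w - (h n)\<^sup>2) \<in> A n i))"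
proof (rule ccontr)
  assume contra: "\<not> ?thesis"
  \<comment> \<open>Here \<open>z = (w, u)\<close>: the squared height comes first, since the shear
    below moves \<open>u\<close> by a function of the first coordinate.\<close>
  define bad where "bad n z \<longleftrightarrow> (h n)\<^sup>2 < fst z \<and> (\<exists>i\<in>{1..m}. snd z + sqrt (fst z - (h n)\<^sup>2) \<in> A n i
    \<and> snd z - sqrt (fst z - (h n)\<^sup>2) \<in> A n i)" for n and z :: "real \<times> real"
  \<comment> \<open>Large enough to contain every \<open>(w, u)\<close> that the pigeonhole argument
    produces from the unit square when \<open>h n \<le> 1\<close>.\<close>
  define K where "K = {0..real (m\<^sup>2) + 1} \<times> {0..real m + 1}"
  define f :: "nat \<Rightarrow> real \<times> real \<Rightarrow> ennreal"
    where "f n z = (if bad n z then 1 else 0) * indicator K z" for n z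
  let ?L = "lborel \<Otimes>\<^sub>M lborel :: (real \<times> real) measure"
  have K_meas [measurable]: "K \<in> sets ?L"
    unfolding K_def by measurable
  have bad_meas [measurable]: "Measurable.pred ?L (bad n)" for n
  proof -
    have [measurable]: "Measurable.pred borel (\<lambda>x. x \<in> A n i)" if "i \<in> {1..m}" for i
      using meas[OF that] by simp
    have "Measurable.pred ?L (\<lambda>z. \<exists>i\<in>{1..m}. snd z + sqrt (fst z - (h n)\<^sup>2) \<in> A n i
        \<and> snd z - sqrt (fst z - (h n)\<^sup>2) \<in> A n i)"
    proof (rule pred_intros_finite(4))
      fix i assume i: "i \<in> {1..m}"
      note [measurable] = meas[OF i]
      show "Measurable.pred ?L (\<lambda>z. snd z + sqrt (fst z - (h n)\<^sup>2) \<in> A n i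
        \<and> snd z - sqrt (fst z - (h n)\<^sup>2) \<in> A n i)"
        by measurable
    qed simp
    then show ?thesis
      unfolding bad_def by measurable
  qed
  have f_meas [measurable]: "f n \<in> borel_measurable ?L" for n
    unfolding f_def by measurable
  have ev: "\<forall>\<^sub>F n in sequentially. \<not> bad n z" for z
  proof (cases "fst z > 0")
    case True
    with contra show ?thesis
      by (auto simp: bad_def not_frequently)
  next
    case False
    have "\<not> bad n z" for n
      using False h(1)[of n] zero_le_power2[of "h n"] unfolding bad_def by linarith
    then show ?thesis by simp
  qed
  have lim: "(\<lambda>n. \<integral>\<^sup>+ z. f n z \<partial>?L) \<longlonglongrightarrow> (\<integral>\<^sup>+ z. 0 \<partial>?L)"
  proof (rule nn_integral_dominated_convergence[where w="indicator K"])
    have "emeasure ?L K < \<infinity>"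
      unfolding K_def by (simp add: lborel.emeasure_pair_measure_Times ennreal_mult_less_top)
    then show "(\<integral>\<^sup>+ z. indicator K z \<partial>?L) < \<infinity>"
      using nn_integral_indicator[OF K_meas] by simp
    show "AE z in ?L. (\<lambda>n. f n z) \<longlonglongrightarrow> 0"
    proof (rule AE_I2)
      fix z :: "real \<times> real"
      show "(\<lambda>n. f n z) \<longlonglongrightarrow> 0"
        by (rule tendsto_eventually, rule eventually_mono[OF ev[of z]]) (simp add: f_def)
    qed
  qed (auto simp: f_def)
  define J where "J = {(j, k). j < k \<and> k \<le> m}"
  have finJ: "finite J"
    by (rule finite_subset[of _ "{..m} \<times> {..m}"]) (auto simp: J_def)
  \<comment> \<open>With \<open>x = s\<^sup>2\<close> and \<open>y = t\<close>, the points
    \<open>t + s * j\<close> and \<open>t + s * k\<close> have midpoint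
    \<open>y + sqrt x * (j + k) / 2\<close> and half-distance \<open>sqrt x * (k - j) / 2\<close>.
    Thus \<open>w\<close> is affine in \<open>x\<close>, with a slope independent of
    \<open>n\<close>.\<close>
  define F where "F n jk x y = f n ((h n)\<^sup>2 + (real (snd jk - fst jk) / 2)\<^sup>2 * x,
     y + sqrt x * (real (fst jk + snd jk) / 2))" for n jk x y
  have F_meas [measurable]: "(\<lambda>z. F n jk (fst z) (snd z)) \<in> borel_measurable ?L" for n jk
    unfolding F_def by measurable
  have F_int: "(\<integral>\<^sup>+ x. \<integral>\<^sup>+ y. F n jk x y \<partial>lborel \<partial>lborel)
      = ennreal (1 / (real (snd jk - fst jk) / 2)\<^sup>2) * (\<integral>\<^sup>+ z. f n z \<partial>?L)" if "jk \<in> J" for n jk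
    unfolding F_def using that
    by (intro nn_integral_shear_affine) (auto simp: J_def)
  \<comment> \<open>At \<open>x = 0\<close> the \<open>m + 1\<close> points would coincide, so
    \<open>x\<close> is kept positive.\<close>
  have pigeonhole: "1 \<le> (\<Sum>jk\<in>J. F n jk x y)"
    if x: "x \<in> {0<..1}" and y: "y \<in> {0..1}" and hn: "h n \<le> 1" for n x y
  proof -
    obtain col where col: "col k \<in> {1..m}" "y + sqrt x * real k \<in> A n (col k)" for k
      using cover[of "y + sqrt x * real _" n] by metis
    have "\<not> inj_on col {..m}"
    proof
      assume "inj_on col {..m}"
      then have "card {..m} \<le> card {1..m}"
        using col by (intro card_inj_on_le[of col]) auto
      then show False by simp
    qed
    then obtain j k where jk: "j < k" "k \<le> m" "col j = col k"
      unfolding inj_on_def by (metis atMost_iff linorder_neqE_nat)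
    define w where "w = (h n)\<^sup>2 + (real (k - j) / 2)\<^sup>2 * x"
    define u where "u = y + sqrt x * (real (j + k) / 2)"
    have r: "sqrt (w - (h n)\<^sup>2) = sqrt x * real (k - j) / 2"
      by (simp add: w_def real_sqrt_mult)
    have "u + sqrt (w - (h n)\<^sup>2) = y + sqrt x * real k" "u - sqrt (w - (h n)\<^sup>2) = y + sqrt x * real j"
      unfolding r using jk by (simp_all add: u_def of_nat_diff field_simps)
    moreover have "(h n)\<^sup>2 < w"
      using x jk by (simp add: w_def)
    ultimately have "bad n (w, u)"
      using col[of j] col[of k] jk by (auto simp: bad_def)
    moreover have "(w, u) \<in> K"
    proof -
      have "(h n)\<^sup>2 \<le> 1"
        using hn h(1)[of n] by (simp add: power_le_one)
      moreover have "(real (k - j) / 2)\<^sup>2 * x \<le> (real m)\<^sup>2 * 1"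
        using x jk by (intro mult_mono power_mono) auto
      moreover have "sqrt x * (real (j + k) / 2) \<le> 1 * real m"
        using x jk by (intro mult_mono) auto
      ultimately show ?thesis
        using x y by (auto simp: K_def w_def u_def)
    qed
    ultimately have "F n (j, k) x y = 1"
      by (simp add: F_def f_def w_def u_def)
    then show ?thesis
      using member_le_sum[of "(j, k)" J "\<lambda>jk. F n jk x y"] finJ jk by (simp add: J_def)
  qed
  \<comment> \<open>The sum of the inverse Jacobians is finite and independent of \<open>n\<close>,
    so a lower bound on \<open>C\<close> times the integral contradicts \<open>lim\<close>.\<close>
  define C where "C = (\<Sum>jk\<in>J. ennreal (1 / (real (snd jk - fst jk) / 2)\<^sup>2))"
  have "1 \<le> C * (\<integral>\<^sup>+ z. f n z \<partial>?L)" if hn: "h n \<le> 1" for n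
  proof -
    have "(1::ennreal) = (\<integral>\<^sup>+ x. \<integral>\<^sup>+ y. indicator {0<..1::real} x * indicator {0..1::real} y \<partial>lborel \<partial>lborel)"
      by (simp add: nn_integral_cmult)
    also have "\<dots> \<le> (\<integral>\<^sup>+ x. \<integral>\<^sup>+ y. (\<Sum>jk\<in>J. F n jk x y) \<partial>lborel \<partial>lborel)"
      using pigeonhole[OF _ _ hn] by (intro nn_integral_mono) (auto simp: indicator_def)
    also have "\<dots> = (\<Sum>jk\<in>J. \<integral>\<^sup>+ x. \<integral>\<^sup>+ y. F n jk x y \<partial>lborel \<partial>lborel)"
      unfolding F_def by (simp add: nn_integral_sum)
    also have "\<dots> = C * (\<integral>\<^sup>+ z. f n z \<partial>?L)"
      unfolding C_def sum_distrib_right by (intro sum.cong refl F_int)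
    finally show ?thesis .
  qed
  moreover have "\<forall>\<^sub>F n in sequentially. h n \<le> 1"
    using order_tendstoD(2)[OF h(2), of 1] by (auto elim: eventually_mono)
  ultimately have "\<forall>\<^sub>F n in sequentially. 1 \<le> C * (\<integral>\<^sup>+ z. f n z \<partial>?L)"
    by (auto elim: eventually_mono)
  moreover have "(\<lambda>n. C * (\<integral>\<^sup>+ z. f n z \<partial>?L)) \<longlonglongrightarrow> C * 0"
  proof (rule ennreal_tendsto_cmult)
    show "C < top"
      by (simp add: C_def)
  qed (use lim in simp)
  ultimately show False
    using tendsto_lowerbound[of "\<lambda>n. C * (\<integral>\<^sup>+ z. f n z \<partial>?L)" "C * 0" sequentially 1] by simp
qed

theorem theorem1:
  fixes m :: nat and B :: "nat \<Rightarrow> hyp_plane set"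
  assumes "\<And>i. i \<in> {1..m} \<Longrightarrow> B i \<in> sets borel"
    and "disjoint_family_on B {1..m}"
    and "(\<Union>i\<in>{1..m}. B i) = UNIV"
  shows "\<exists>i\<in>{1..m}. \<exists>S. S \<subseteq> B i \<and> \<not> bounded S \<and> (\<exists>c. symmetric_wrt S c)"
proof -
  define h :: "nat \<Rightarrow> real" where "h n = inverse (real (Suc n))" for n
  have h: "h n > 0" "h \<longlonglongrightarrow> 0" for n
    using LIMSEQ_inverse_real_of_nat by (simp_all add: h_def[abs_def])
  have "(\<lambda>x. hyp_xy x (h n)) -` B i \<in> sets borel" if "i \<in> {1..m}" for n i
    using measurable_sets[OF borel_measurable_continuous_onI[OF continuous_on_hyp_xy_horocycle[OF h(1)]]
        assms(1)[OF that]] by simp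
  moreover have "\<exists>i\<in>{1..m}. x \<in> (\<lambda>x. hyp_xy x (h n)) -` B i" for n x
    using assms(3) by auto
  ultimately obtain u w where w: "w > 0" and freq: "\<exists>\<^sub>F n in sequentially. (h n)\<^sup>2 < w \<and>
      (\<exists>i\<in>{1..m}. u + sqrt (w - (h n)\<^sup>2) \<in> (\<lambda>x. hyp_xy x (h n)) -` B i
        \<and> u - sqrt (w - (h n)\<^sup>2) \<in> (\<lambda>x. hyp_xy x (h n)) -` B i)"
    using frequently_monochromatic_pair[OF h(1) h(2), where A="\<lambda>n i. (\<lambda>x. hyp_xy x (h n)) -` B i" and m=m]
    by blast
  let ?c = "hyp_xy u (sqrt w)"
  have "\<exists>i\<in>{1..m}. \<not> bounded {p \<in> B i. central_symmetry ?c p \<in> B i}"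
  proof (rule ccontr)
    assume "\<not> ?thesis"
    \<comment> \<open>There are finitely many pieces, so a single threshold for \<open>n\<close>
      works for all of them.\<close>
    then have "\<forall>\<^sub>F n in sequentially. \<forall>i\<in>{1..m}. (h n)\<^sup>2 < w \<longrightarrow>
        \<not> (hyp_xy (u + sqrt (w - (h n)\<^sup>2)) (h n) \<in> B i \<and> hyp_xy (u - sqrt (w - (h n)\<^sup>2)) (h n) \<in> B i)"
      using eventually_horocycle_pair_separated[OF h(1) h(2) w]
      by (intro eventually_ball_finite) auto
    then show False
      using freq unfolding frequently_def by (auto elim!: notE eventually_mono)
  qed
  then obtain i where "i \<in> {1..m}" "\<not> bounded {p \<in> B i. central_symmetry ?c p \<in> B i}" ..
  moreover have "{p \<in> B i. central_symmetry ?c p \<in> B i} \<subseteq> B i" by auto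
  ultimately show ?thesis
    using symmetric_wrt_Int_vimage[of "B i" ?c] by blast
qed

end
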